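(* Let $\mathfrak{n}=\mathfrak{sl}_3(\mathbb{C})$ with its commutator bracket denoted $\{\,,\}$, and with basis $e_1=E_{12}$, $e_2=E_{13}$, $e_3=E_{21}$, $e_4=E_{23}$, $e_5=E_{31}$, $e_6=E_{32}$, $e_7=E_{11}-E_{22}$, $e_8=E_{22}-E_{33}$. Then there exists a post-Lie algebra structure on a pair $(\mathfrak{g},\mathfrak{n})$ with $\mathfrak{g}\cong\mathfrak{aff}_2(\mathbb{C})\oplus\mathfrak{aff}_1(\mathbb{C})$. More precisely, let $\phi$ be the linear map on $\mathfrak{n}$ with $$\phi(e_3)=-e_3-e_7,\qquad \phi(e_4)=-e_4-e_5,\qquad \phi(e_i)=0\ \text{ for } i=1,2,5,6,7,8.$$ Then $x\cdot y=\{\phi(x),y\}$ defines a post-Lie algebra structure on the pair $(\mathfrak{g},\mathfrak{n})$, where $\mathfrak{g}\cong\mathfrak{aff}_2(\mathbb{C})\oplus\mathfrak{aff}_1(\mathbb{C})$ is the Lie algebra on the vector space of $\mathfrak{n}$ whose Lie brackets $[e_i,e_j]$, $i<j$, are $[e_1,e_3]=2e_1$, $[e_1,e_4]=e_6$, $[e_1,e_5]=-e_6$, $[e_1,e_7]=-2e_1$, $[e_1,e_8]=e_1$, $[e_2,e_3]=e_2$, $[e_2,e_4]=-e_7-e_8$, $[e_2,e_5]=e_7+e_8$, $[e_2,e_6]=e_1$, $[e_2,e_7]=-e_2$, $[e_2,e_8]=-e_2$, $[e_3,e_4]=e_4$, $[e_3,e_5]=e_5$, $[e_3,e_6]=-e_6$,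 $[e_4,e_7]=-e_5$, $[e_4,e_8]=-e_5$, $[e_5,e_7]=e_5$, $[e_5,e_8]=e_5$, $[e_6,e_7]=-e_6$, $[e_6,e_8]=2e_6$, with all other $[e_i,e_j]$, $i<j$, equal to zero. The products are given explicitly by $e_3\cdot e_1=-2e_1+e_7$, $e_3\cdot e_2=-e_2-e_4$, $e_3\cdot e_3=2e_3$, $e_3\cdot e_4=e_4$, $e_3\cdot e_5=e_5$, $e_3\cdot e_6=e_5-e_6$, $e_3\cdot e_7=-2e_3$, $e_3\cdot e_8=e_3$, $e_4\cdot e_1=e_2-e_6$, $e_4\cdot e_2=e_7+e_8$, $e_4\cdot e_4=e_3$, $e_4\cdot e_5=-e_3$, $e_4\cdot e_6=-e_8$, $e_4\cdot e_7=-e_4-e_5$, $e_4\cdot e_8=2e_4-e_5$, with all other products $e_i\cdot e_j$ equal to zero.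
   Context: Let $\mathfrak{g}=(V,[\,,])$ and $\mathfrak{n}=(V,\{\,,\})$ be two Lie algebra structures on the same complex vector space $V$. A post-Lie algebra structure on the pair $(\mathfrak{g},\mathfrak{n})$ is a bilinear product $(x,y)\mapsto x\cdot y$ on $V$ such that for all $x,y,z\in V$: (i) $x\cdot y-y\cdot x=[x,y]-\{x,y\}$; (ii) $[x,y]\cdot z=x\cdot(y\cdot z)-y\cdot(x\cdot z)$; (iii) $x\cdot\{y,z\}=\{x\cdot y,z\}+\{y,x\cdot z\}$. Such a structure is called inner when it has the form $x\cdot y=\{\phi(x),y\}$ for a linear map $\phi$. $E_{ij}$ is the matrix with entry $1$ at position $(i,j)$ and zeros elsewhere. $\mathfrak{aff}_n(\mathbb{C})=\mathfrak{gl}_n(\mathbb{C})\ltimes\mathbb{C}^n$ is the affine Lie algebra of dimension $n^2+n$, with $\mathfrak{gl}_n(\mathbb{C})$ acting naturally on the abelian ideal $\mathbb{C}^n$; $\mathfrak{aff}_1(\mathbb{C})$ is the $2$-dimensional non-abelian Lie algebra. *)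

theory Defs
  imports "HOL-Analysis.Analysis"
begin

text \<open>
  A vector space over \<open>'k\<close> is a subspace \<open>V\<close> of a type with scalar multiplication \<open>s\<close>, so that
  \<open>sl\<^sub>3\<close> can be taken as a set of matrices. Maps are only constrained on the carrier.
\<close>

definition linear_on ::
  "('k::field \<Rightarrow> 'a::ab_group_add \<Rightarrow> 'a) \<Rightarrow> ('k \<Rightarrow> 'b::ab_group_add \<Rightarrow> 'b) \<Rightarrow> 'a set \<Rightarrow> 'b set
    \<Rightarrow> ('a \<Rightarrow> 'b) \<Rightarrow> bool" where
  "linear_on s t V W f \<longleftrightarrow>
     (\<forall>x\<in>V. f x \<in> W) \<and>
     (\<forall>x\<in>V. \<forall>y\<in>V. f (x + y) = f x + f y) \<and>
     (\<forall>c. \<forall>x\<in>V. f (s c x) = t c (f x))"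

definition bilinear_on ::
  "('k::field \<Rightarrow> 'a::ab_group_add \<Rightarrow> 'a) \<Rightarrow> 'a set \<Rightarrow> ('a \<Rightarrow> 'a \<Rightarrow> 'a) \<Rightarrow> bool" where
  "bilinear_on s V m \<longleftrightarrow>
     (\<forall>x\<in>V. linear_on s s V V (\<lambda>y. m x y)) \<and> (\<forall>y\<in>V. linear_on s s V V (\<lambda>x. m x y))"

locale lie_algebra = vector_space s
  for s :: "'k::field \<Rightarrow> 'a::ab_group_add \<Rightarrow> 'a" +
  fixes V :: "'a set" and br :: "'a \<Rightarrow> 'a \<Rightarrow> 'a"
  assumes subspace: "subspace V"
    and bilinear: "bilinear_on s V br"
    and alternating: "x \<in> V \<Longrightarrow> br x x = 0"
    and jacobi: "x \<in> V \<Longrightarrow> y \<in> V \<Longrightarrow> z \<in> V \<Longrightarrow>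
           br x (br y z) + br y (br z x) + br z (br x y) = 0"

text \<open>Post-Lie algebra structures on the pair \<open>((V, g), (V, n))\<close>.\<close>

locale post_lie_structure =
  g: lie_algebra s V g + n: lie_algebra s V n
  for s :: "complex \<Rightarrow> 'a::ab_group_add \<Rightarrow> 'a" and V :: "'a set"
    and g :: "'a \<Rightarrow> 'a \<Rightarrow> 'a" and n :: "'a \<Rightarrow> 'a \<Rightarrow> 'a" +
  fixes p :: "'a \<Rightarrow> 'a \<Rightarrow> 'a"
  assumes bilinear: "bilinear_on s V p"
    and commutation: "x \<in> V \<Longrightarrow> y \<in> V \<Longrightarrow> p x y - p y x = g x y - n x y"
    and action: "x \<in> V \<Longrightarrow> y \<in> V \<Longrightarrow> z \<in> V \<Longrightarrow> p (g x y) z = p x (p y z) - p y (p x z)"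
    and derivation: "x \<in> V \<Longrightarrow> y \<in> V \<Longrightarrow> z \<in> V \<Longrightarrow> p x (n y z) = n (p x y) z + n y (p x z)"

definition lie_isomorphic ::
  "('k::field \<Rightarrow> 'a::ab_group_add \<Rightarrow> 'a) \<Rightarrow> 'a set \<Rightarrow> ('a \<Rightarrow> 'a \<Rightarrow> 'a) \<Rightarrow>
   ('k \<Rightarrow> 'b::ab_group_add \<Rightarrow> 'b) \<Rightarrow> 'b set \<Rightarrow> ('b \<Rightarrow> 'b \<Rightarrow> 'b) \<Rightarrow> bool" where
  "lie_isomorphic s V br t W br' \<longleftrightarrow>
     lie_algebra s V br \<and> lie_algebra t W br' \<and>
     (\<exists>f. linear_on s t V W f \<and> bij_betw f V W \<and> (\<forall>x\<in>V. \<forall>y\<in>V. f (br x y) = br' (f x) (f y)))"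

definition direct_sum_bracket ::
  "('a \<Rightarrow> 'a \<Rightarrow> 'a) \<Rightarrow> ('b \<Rightarrow> 'b \<Rightarrow> 'b) \<Rightarrow> 'a \<times> 'b \<Rightarrow> 'a \<times> 'b \<Rightarrow> 'a \<times> 'b" where
  "direct_sum_bracket br br' x y = (br (fst x) (fst y), br' (snd x) (snd y))"

text \<open>On matrices the library operation \<open>(*s)\<close> takes a row vector as scalar, not a complex number.\<close>

definition mat_scale :: "complex \<Rightarrow> complex^'n^'m \<Rightarrow> complex^'n^'m" (infixr "*\<^sub>C" 75) where
  "c *\<^sub>C A = (\<chi> i j. c * A $ i $ j)"

definition commutator :: "complex^'n^'n \<Rightarrow> complex^'n^'n \<Rightarrow> complex^'n^'n" where
  "commutator A B = A ** B - B ** A"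

text \<open>
  The affine Lie algebra \<open>gl\<^sub>n(\<complex>) \<ltimes> \<complex>\<^sup>n\<close> lives on the whole type of pairs; \<open>n\<close> is the cardinality
  of the index type, so the cases needed here use the numeral types \<open>2\<close> and \<open>1\<close>.
\<close>

definition aff_scale :: "complex \<Rightarrow> (complex^'n^'n) \<times> (complex^'n) \<Rightarrow> (complex^'n^'n) \<times> (complex^'n)" where
  "aff_scale = module_prod.scale mat_scale (*s)"

definition aff_bracket ::
  "(complex^'n^'n) \<times> (complex^'n) \<Rightarrow> (complex^'n^'n) \<times> (complex^'n) \<Rightarrow> (complex^'n^'n) \<times> (complex^'n)" where
  "aff_bracket x y = (commutator (fst x) (fst y), fst x *v snd y - fst y *v snd x)"

definition sl3 :: "(complex^3^3) set" where
  "sl3 = {A. trace A = 0}"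

definition mat_unit :: "3 \<Rightarrow> 3 \<Rightarrow> complex^3^3" where
  "mat_unit i j = axis i (axis j 1)"

text \<open>Only the indices \<open>1, \<dots>, 8\<close> are meaningful.\<close>

definition e :: "nat \<Rightarrow> complex^3^3" where
  "e i = [mat_unit 1 2, mat_unit 1 3, mat_unit 2 1, mat_unit 2 3, mat_unit 3 1, mat_unit 3 2,
          mat_unit 1 1 - mat_unit 2 2, mat_unit 2 2 - mat_unit 3 3] ! (i - 1)"

text \<open>Pairs \<open>(i, j)\<close> missing from a table denote \<open>0\<close>; \<open>g_table\<close> is used for \<open>i < j\<close> only.\<close>

definition table_entry :: "((nat \<times> nat) \<times> (complex^3^3)) list \<Rightarrow> nat \<Rightarrow> nat \<Rightarrow> complex^3^3" where
  "table_entry T i j = (case map_of T (i, j) of None \<Rightarrow> 0 | Some x \<Rightarrow> x)"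

definition g_table :: "((nat \<times> nat) \<times> (complex^3^3)) list" where
  "g_table =
    [((1,3), 2 *\<^sub>C e 1), ((1,4), e 6), ((1,5), - e 6), ((1,7), - 2 *\<^sub>C e 1), ((1,8), e 1),
     ((2,3), e 2), ((2,4), - e 7 - e 8), ((2,5), e 7 + e 8), ((2,6), e 1), ((2,7), - e 2),
     ((2,8), - e 2),
     ((3,4), e 4), ((3,5), e 5), ((3,6), - e 6),
     ((4,7), - e 5), ((4,8), - e 5),
     ((5,7), e 5), ((5,8), e 5),
     ((6,7), - e 6), ((6,8), 2 *\<^sub>C e 6)]"

definition product_table :: "((nat \<times> nat) \<times> (complex^3^3)) list" where
  "product_table =
    [((3,1), - 2 *\<^sub>C e 1 + e 7), ((3,2), - e 2 - e 4), ((3,3), 2 *\<^sub>C e 3), ((3,4), e 4),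
     ((3,5), e 5), ((3,6), e 5 - e 6), ((3,7), - 2 *\<^sub>C e 3), ((3,8), e 3),
     ((4,1), e 2 - e 6), ((4,2), e 7 + e 8), ((4,4), e 3), ((4,5), - e 3), ((4,6), - e 8),
     ((4,7), - e 4 - e 5), ((4,8), 2 *\<^sub>C e 4 - e 5)]"

abbreviation iso_aff2_aff1 :: "(complex^3^3 \<Rightarrow> complex^3^3 \<Rightarrow> complex^3^3) \<Rightarrow> bool" where
  "iso_aff2_aff1 g \<equiv>
     lie_isomorphic mat_scale sl3 g
       (module_prod.scale aff_scale aff_scale) (UNIV \<times> UNIV)
       (direct_sum_bracket
         (aff_bracket :: (complex^2^2) \<times> (complex^2) \<Rightarrow> _)
         (aff_bracket :: (complex^1^1) \<times> (complex^1) \<Rightarrow> _))"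

definition is_phi :: "(complex^3^3 \<Rightarrow> complex^3^3) \<Rightarrow> bool" where
  "is_phi \<phi> \<longleftrightarrow>
     linear_on mat_scale mat_scale sl3 sl3 \<phi> \<and>
     \<phi> (e 3) = - e 3 - e 7 \<and> \<phi> (e 4) = - e 4 - e 5 \<and> (\<forall>i\<in>{1,2,5,6,7,8}. \<phi> (e i) = 0)"

end

theory Submission
  imports Defs
begin

text \<open>
  Write \<open>\<nn> = \<aa> \<oplus> \<bb>\<close>, where \<open>\<aa>\<close> is the parabolic subalgebra of all \<open>X\<close> in \<open>sl\<^sub>3\<close> with
  \<open>X\<^sub>2\<^sub>1 = X\<^sub>2\<^sub>3 = 0\<close> and \<open>\<bb>\<close> is spanned by \<open>e\<^sub>3 + e\<^sub>7\<close> and \<open>e\<^sub>4 + e\<^sub>5\<close>. Both are subalgebras; for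
  \<open>\<bb>\<close> this is the relation \<open>{e\<^sub>3 + e\<^sub>7, e\<^sub>4 + e\<^sub>5} = - (e\<^sub>4 + e\<^sub>5)\<close>. The prescribed \<open>\<phi>\<close> is minus the
  projection onto \<open>\<bb>\<close> along \<open>\<aa>\<close>.

  Minus the projection of such a splitting is a Rota--Baxter operator of weight one
  (\<open>splitting_rota_baxter\<close>), and for every such operator \<open>\<phi>\<close> the product \<open>x \<cdot> y = {\<phi> x, y}\<close> is a
  post-Lie structure, whose first Lie bracket is
  \<open>[x, y] = {\<phi> x, y} + {x, \<phi> y} + {x, y}\<close> (\<open>rota_baxter_post_lie\<close>). In terms of the components of
  \<open>x\<close> and \<open>y\<close> this bracket is \<open>{x\<^sub>\<aa>, y\<^sub>\<aa>} - {x\<^sub>\<bb>, y\<^sub>\<bb>}\<close>, so \<open>\<gg>\<close> is the direct sum of the Lie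
  algebra \<open>\<aa>\<close> and of \<open>\<bb>\<close> with the opposite bracket. The latter is \<open>aff\<^sub>1\<close>.

  For \<open>\<aa>\<close>, let \<open>M\<close> be the block of \<open>X\<close> with rows and columns \<open>1, 3\<close> and let
  \<open>v = (X\<^sub>1\<^sub>2, X\<^sub>3\<^sub>2)\<close>. In the commutator of two such matrices, \<open>M\<close> acts on the other vector through
  \<open>M - X\<^sub>2\<^sub>2 I\<close>. Since \<open>X\<^sub>2\<^sub>2 = - trace M\<close>, the matrix \<open>M - X\<^sub>2\<^sub>2 I\<close> ranges over all of \<open>gl\<^sub>2\<close>, and
  \<open>X \<mapsto> (M - X\<^sub>2\<^sub>2 I, v)\<close> is an isomorphism of \<open>\<aa>\<close> onto \<open>aff\<^sub>2\<close> (\<open>iso_g_bracket\<close>). A linear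
  map with the prescribed values on the basis agrees with this \<open>\<phi>\<close> on \<open>sl\<^sub>3\<close> (\<open>is_phi_unique\<close>), so it
  gives the same structure.
\<close>

section \<open>Rota--Baxter operators and post-Lie structures\<close>

context lie_algebra
begin

lemma closed [simp]: "x \<in> V \<Longrightarrow> y \<in> V \<Longrightarrow> br x y \<in> V"
  and add_right: "x \<in> V \<Longrightarrow> y \<in> V \<Longrightarrow> z \<in> V \<Longrightarrow> br x (y + z) = br x y + br x z"
  and add_left: "x \<in> V \<Longrightarrow> y \<in> V \<Longrightarrow> z \<in> V \<Longrightarrow> br (x + y) z = br x z + br y z"
  and scale_right: "x \<in> V \<Longrightarrow> y \<in> V \<Longrightarrow> br x (s c y) = s c (br x y)"
  and scale_left: "x \<in> V \<Longrightarrow> y \<in> V \<Longrightarrow> br (s c x) y = s c (br x y)"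
  using bilinear unfolding bilinear_on_def linear_on_def by auto

lemma add_closed [simp]: "x \<in> V \<Longrightarrow> y \<in> V \<Longrightarrow> x + y \<in> V"
  and scale_closed [simp]: "x \<in> V \<Longrightarrow> s c x \<in> V"
  using subspace by (auto intro: subspace_add subspace_scale)

lemma antisymmetric: "br x y = - br y x" if "x \<in> V" "y \<in> V"
proof -
  have "br x y + br y x = br (x + y) (x + y)"
    using that by (simp add: add_left add_right alternating[of x] alternating[of y])
  also have "\<dots> = 0"
    using that by (intro alternating add_closed)
  finally show ?thesis
    by (simp add: eq_neg_iff_add_eq_0)
qed

lemma leibniz: "br x (br y z) = br (br x y) z + br y (br x z)" 
  if "x \<in> V" "y \<in> V" "z \<in> V"
proof -
  have "br y (br z x) = - br y (br x z)"
    using that scale_right[of y "br x z" "-1"] antisymmetric[of z x] by simp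
  moreover have "br z (br x y) = - br (br x y) z"
    using that by (intro antisymmetric closed)
  ultimately show ?thesis
    using jacobi[OF that] by (simp add: algebra_simps)
qed

end

text \<open>
  The bracket that a Rota--Baxter operator \<open>R\<close> of weight one induces from \<open>n\<close>. It is the one forced by
  \<open>x \<cdot> y - y \<cdot> x = [x, y] - {x, y}\<close> when \<open>x \<cdot> y = {R x, y}\<close>.
\<close>

definition rb_bracket :: "('a::ab_group_add \<Rightarrow> 'a \<Rightarrow> 'a) \<Rightarrow> ('a \<Rightarrow> 'a) \<Rightarrow> 'a \<Rightarrow> 'a \<Rightarrow> 'a" where
  "rb_bracket n R x y = n (R x) y + n x (R y) + n x y"

locale rota_baxter_operator = lie_algebra s V n
  for s :: "'k::field \<Rightarrow> 'a::ab_group_add \<Rightarrow> 'a" and V :: "'a set" and n :: "'a \<Rightarrow> 'a \<Rightarrow> 'a" +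
  fixes R :: "'a \<Rightarrow> 'a"
  assumes R_linear: "linear_on s s V V R"
    and rota_baxter: "x \<in> V \<Longrightarrow> y \<in> V \<Longrightarrow> R (rb_bracket n R x y) = n (R x) (R y)"
begin

lemma R_closed [simp]: "x \<in> V \<Longrightarrow> R x \<in> V"
  and R_add: "x \<in> V \<Longrightarrow> y \<in> V \<Longrightarrow> R (x + y) = R x + R y"
  and R_scale: "x \<in> V \<Longrightarrow> R (s c x) = s c (R x)"
  using R_linear unfolding linear_on_def by auto

text \<open>
  Expanding with the Rota--Baxter identity, \<open>[x, [y, z]]\<close> becomes the sum of all \<open>{x', {y', z'}}\<close>
  where each letter may carry an \<open>R\<close>, except the term in which all three do. Hence the Jacobi sum
  splits into seven Jacobi sums for \<open>n\<close>.
\<close>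

lemma rb_bracket_lie_algebra: "lie_algebra s V (rb_bracket n R)"
proof unfold_locales
  show "subspace V" by (rule subspace)
  show "bilinear_on s V (rb_bracket n R)"
    unfolding bilinear_on_def linear_on_def rb_bracket_def
    by (simp add: add_left add_right scale_left scale_right R_add R_scale scale_right_distrib ac_simps)
  show "rb_bracket n R x x = 0" if "x \<in> V" for x
    using that antisymmetric[of x "R x"] by (simp add: rb_bracket_def alternating)
  show "rb_bracket n R x (rb_bracket n R y z) + rb_bracket n R y (rb_bracket n R z x)
      + rb_bracket n R z (rb_bracket n R x y) = 0"
    if V: "x \<in> V" "y \<in> V" "z \<in> V" for x y z
  proof -
    let ?J = "\<lambda>x y z. n x (n y z) + n y (n z x) + n z (n x y)"
    have expand: "rb_bracket n R x (rb_bracket n R y z) =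
        n (R x) (n (R y) z) + n (R x) (n y (R z)) + n (R x) (n y z)
        + n x (n (R y) (R z))
        + n x (n (R y) z) + n x (n y (R z)) + n x (n y z)"
      if "x \<in> V" "y \<in> V" "z \<in> V" for x y z
      using that by (subst rb_bracket_def)
        (simp add: rota_baxter, simp add: rb_bracket_def add_right ac_simps)
    have "rb_bracket n R x (rb_bracket n R y z) + rb_bracket n R y (rb_bracket n R z x)
        + rb_bracket n R z (rb_bracket n R x y)
      = ?J x y z + ?J (R x) y z + ?J x (R y) z + ?J x y (R z)
        + ?J (R x) (R y) z + ?J (R x) y (R z) + ?J x (R y) (R z)"
      using V by (simp only: expand ac_simps)
    also have "\<dots> = 0"
      using V by (simp add: jacobi)
    finally show ?thesis .
  qed
qed

end

text \<open>
  The Rota--Baxter identity says that \<open>R\<close> is a homomorphism from the induced bracket to \<open>n\<close>, so the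
  action axiom holds because \<open>ad\<close> is a representation; the derivation axiom holds because every
  \<open>ad (R x)\<close> is a derivation of \<open>n\<close>.
\<close>

lemma rota_baxter_post_lie:
  fixes s :: "complex \<Rightarrow> 'a::ab_group_add \<Rightarrow> 'a"
  assumes "rota_baxter_operator s V n R"
  shows "post_lie_structure s V (rb_bracket n R) n (\<lambda>x y. n (R x) y)"
proof -
  interpret rota_baxter_operator s V n R by fact
  interpret g: lie_algebra s V "rb_bracket n R" by (rule rb_bracket_lie_algebra)
  show ?thesis
  proof unfold_locales
    show "bilinear_on s V (\<lambda>x y. n (R x) y)"
      unfolding bilinear_on_def linear_on_def
      by (simp add: add_left add_right scale_left scale_right R_add R_scale)
    show "n (R x) y - n (R y) x = rb_bracket n R x y - n x y" if "x \<in> V" "y \<in> V" for x y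
      using that antisymmetric[of x "R y"] by (simp add: rb_bracket_def)
    show "n (R (rb_bracket n R x y)) z = n (R x) (n (R y) z) - n (R y) (n (R x) z)"
      if "x \<in> V" "y \<in> V" "z \<in> V" for x y z
      using that leibniz[of "R x" "R y" z] by (simp add: rota_baxter)
    show "n (R x) (n y z) = n (n (R x) y) z + n y (n (R x) z)"
      if "x \<in> V" "y \<in> V" "z \<in> V" for x y z
      using that by (intro leibniz R_closed)
  qed
qed

text \<open>
  The condition \<open>R (R x) = - R x\<close> makes \<open>- R\<close> the projection onto its range along its kernel, with
  \<open>x + R x\<close> as the kernel component. Since the kernel is a subalgebra, \<open>R\<close> kills the bracket of the
  kernel components of \<open>x\<close> and \<open>y\<close>, which exceeds the induced bracket by \<open>{R x, R y}\<close>; on that term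
  \<open>R\<close> is \<open>- 1\<close> because the range is a subalgebra.
\<close>

lemma splitting_rota_baxter:
  assumes "lie_algebra s V n" and R: "linear_on s s V V R"
    and idem: "\<And>x. x \<in> V \<Longrightarrow> R (R x) = - R x"
    and ker: "\<And>x y. x \<in> V \<Longrightarrow> y \<in> V \<Longrightarrow> R x = 0 \<Longrightarrow> R y = 0 \<Longrightarrow> R (n x y) = 0"
    and range: "\<And>x y. x \<in> V \<Longrightarrow> y \<in> V \<Longrightarrow> R (n (R x) (R y)) = - n (R x) (R y)"
  shows "rota_baxter_operator s V n R"
proof -
  interpret lie_algebra s V n by fact
  have RV [simp]: "x \<in> V \<Longrightarrow> R x \<in> V"
    and R_add: "x \<in> V \<Longrightarrow> y \<in> V \<Longrightarrow> R (x + y) = R x + R y" for x y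
    using R unfolding linear_on_def by auto
  show ?thesis
  proof
    show "linear_on s s V V R" by fact
    fix x y assume V: "x \<in> V" "y \<in> V"
    have rbV: "rb_bracket n R x y \<in> V"
      using V by (simp add: rb_bracket_def)
    have "n (x + R x) (y + R y) = rb_bracket n R x y + n (R x) (R y)"
      using V by (simp add: rb_bracket_def add_left add_right ac_simps)
    moreover have "R (n (x + R x) (y + R y)) = 0"
      using V by (intro ker) (simp_all add: R_add idem)
    ultimately have "R (rb_bracket n R x y) + R (n (R x) (R y)) = 0"
      using V rbV by (simp add: R_add)
    then show "R (rb_bracket n R x y) = n (R x) (R y)"
      using V by (simp add: range)
  qed
qed

section \<open>The Lie algebras of matrices\<close>

lemma mat_scale_nth [simp]: "(c *\<^sub>C A) $ i $ j = c * A $ i $ j"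
  by (simp add: mat_scale_def)

interpretation mat: vector_space "mat_scale :: complex \<Rightarrow> complex^'n^'m \<Rightarrow> complex^'n^'m"
  by unfold_locales (simp_all add: vec_eq_iff algebra_simps)

lemma mat_scale_mult: "(c *\<^sub>C A) ** B = c *\<^sub>C (A ** B)" "A ** (c *\<^sub>C B) = c *\<^sub>C (A ** B)"
  by (simp_all add: vec_eq_iff matrix_matrix_mult_def sum_distrib_left ac_simps)

lemma mat_add_rdistrib: "(A + B) ** C = A ** C + B ** (C :: complex^'n^'n)"
  by (simp add: vec_eq_iff matrix_matrix_mult_def sum.distrib algebra_simps)

lemma mat_mult_diff: "A ** (B - C) = A ** B - A ** (C :: complex^'n^'n)"
   "(A - B) ** C = A ** C - B ** (C :: complex^'n^'n)"
  by (simp_all add: vec_eq_iff matrix_matrix_mult_def sum_subtractf algebra_simps)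

lemma commutator_bilinear:
  "commutator A (B + C) = commutator A B + commutator A C"
  "commutator (A + B) C = commutator A C + commutator B C"
  "commutator A (c *\<^sub>C B) = c *\<^sub>C commutator A B"
  "commutator (c *\<^sub>C A) B = c *\<^sub>C commutator A B"
  by (simp_all add: commutator_def matrix_add_ldistrib mat_add_rdistrib mat_scale_mult
      mat.scale_right_diff_distrib)

lemma commutator_jacobi:
  "commutator A (commutator B C) + commutator B (commutator C A)
    + commutator C (commutator A B) = 0"
  by (simp add: commutator_def mat_mult_diff matrix_mul_assoc)

lemma commutator_zero: "commutator 0 B = 0" "commutator A 0 = 0"
  by (simp_all add: commutator_def)

lemma commutator_nth_3:
  "commutator A B $ i $ j = A$i$1 * B$1$j + A$i$2 * B$2$j + A$i$3 * B$3$j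
    - (B$i$1 * A$1$j + B$i$2 * A$2$j + B$i$3 * A$3$j)" for A B :: "complex^3^3"
  by (simp add: commutator_def matrix_matrix_mult_def sum_3)

lemma trace_commutator: "trace (commutator A B) = 0"
  by (simp add: commutator_def trace_sub trace_mul_sym[of A B])

lemma sl3_lie_algebra: "lie_algebra mat_scale sl3 commutator"
proof unfold_locales
  show "mat.subspace sl3"
    by (auto simp: mat.subspace_def sl3_def trace_add)
       (simp_all add: trace_def flip: sum_distrib_left)
  show "bilinear_on mat_scale sl3 commutator"
    unfolding bilinear_on_def linear_on_def
    by (simp add: sl3_def trace_commutator commutator_bilinear)
  show "commutator A A = 0" for A :: "complex^3^3"
    by (simp add: commutator_def)
qed (rule commutator_jacobi)

lemma mat_vec_scale: "(c *\<^sub>C A) *v v = c *s (A *v v)" "A *v (c *s v) = c *s (A *v v)"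
  by (simp_all add: vec_eq_iff matrix_vector_mult_def sum_distrib_left ac_simps)

interpretation aff: vector_space_prod
  "mat_scale :: complex \<Rightarrow> complex^'n^'n \<Rightarrow> _" "(*s) :: complex \<Rightarrow> complex^'n \<Rightarrow> complex^'n"
  rewrites "module_prod.scale mat_scale (*s) = aff_scale"
proof -
  show "vector_space_prod (mat_scale :: complex \<Rightarrow> complex^'n^'n \<Rightarrow> _) ((*s) :: complex \<Rightarrow> complex^'n \<Rightarrow> _)"
    by unfold_locales
qed (simp add: aff_scale_def)

lemma aff_scale_apply: "aff_scale c x = (c *\<^sub>C fst x, c *s snd x)"
  by (rule aff.scale_def)

lemma aff_lie_algebra: "lie_algebra aff_scale UNIV (aff_bracket :: _ \<Rightarrow> _ \<Rightarrow> (complex^'n^'n) \<times> (complex^'n))"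
proof unfold_locales
  show "aff.p.subspace UNIV" by simp
  show "bilinear_on aff_scale UNIV (aff_bracket :: _ \<Rightarrow> _ \<Rightarrow> (complex^'n^'n) \<times> (complex^'n))"
    unfolding bilinear_on_def linear_on_def
    by (simp add: aff_bracket_def aff_scale_apply commutator_bilinear mat_vec_scale
        algebra_simps vec.scale_right_diff_distrib)
  show "aff_bracket x x = 0" for x :: "(complex^'n^'n) \<times> (complex^'n)"
    by (simp add: aff_bracket_def commutator_def zero_prod_def)
  show "aff_bracket x (aff_bracket y z) + aff_bracket y (aff_bracket z x)
      + aff_bracket z (aff_bracket x y) = 0" for x y z :: "(complex^'n^'n) \<times> (complex^'n)"
    by (simp add: aff_bracket_def commutator_jacobi zero_prod_def)
       (simp add: commutator_def algebra_simps matrix_vector_mul_assoc)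
qed

lemma direct_sum_lie_algebra:
  assumes "lie_algebra s V br" "lie_algebra t W br'"
  shows "lie_algebra (module_prod.scale s t) (V \<times> W) (direct_sum_bracket br br')"
proof -
  interpret a: lie_algebra s V br by fact
  interpret b: lie_algebra t W br' by fact
  interpret vector_space_prod s t ..
  show ?thesis
  proof unfold_locales
    show "p.subspace (V \<times> W)"
      by (intro subspace_Times a.subspace b.subspace)
    show "bilinear_on scale (V \<times> W) (direct_sum_bracket br br')"
      unfolding bilinear_on_def linear_on_def
      by (auto simp: direct_sum_bracket_def scale_def a.add_left a.add_right a.scale_left
          a.scale_right b.add_left b.add_right b.scale_left b.scale_right)
  qed (auto simp: direct_sum_bracket_def a.alternating b.alternating a.jacobi b.jacobi
      zero_prod_def)
qed

section \<open>The basis\<close>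

lemma mat_unit_nth: "mat_unit i j $ k $ l = (if i = k \<and> j = l then 1 else 0)"
  by (auto simp: mat_unit_def axis_def)

(* The duplicated entry for Suc 0 is there because simp rewrites the index 1 to Suc 0. *)
lemma e_nth:
  "e 1 $ i $ j = (if i = 1 \<and> j = 2 then 1 else 0)"
  "e (Suc 0) $ i $ j = (if i = 1 \<and> j = 2 then 1 else 0)"
  "e 2 $ i $ j = (if i = 1 \<and> j = 3 then 1 else 0)"
  "e 3 $ i $ j = (if i = 2 \<and> j = 1 then 1 else 0)"
  "e 4 $ i $ j = (if i = 2 \<and> j = 3 then 1 else 0)"
  "e 5 $ i $ j = (if i = 3 \<and> j = 1 then 1 else 0)"
  "e 6 $ i $ j = (if i = 3 \<and> j = 2 then 1 else 0)"
  "e 7 $ i $ j = (if i = 1 \<and> j = 1 then 1 else 0) - (if i = 2 \<and> j = 2 then 1 else 0)"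
  "e 8 $ i $ j = (if i = 2 \<and> j = 2 then 1 else 0) - (if i = 3 \<and> j = 3 then 1 else 0)"
  by (auto simp: e_def mat_unit_nth)

text \<open>
  The linear forms dual to the basis: on \<open>sl\<^sub>3\<close>, \<open>coord i\<close> is the \<open>i\<close>-th coordinate. The last one is
  \<open>X\<^sub>1\<^sub>1 + X\<^sub>2\<^sub>2\<close> because \<open>e\<^sub>7\<close> contributes \<open>- X\<^sub>1\<^sub>1\<close> to the entry \<open>(2, 2)\<close>.
\<close>

definition coord :: "nat \<Rightarrow> complex^3^3 \<Rightarrow> complex" where
  "coord i X = [X$1$2, X$1$3, X$2$1, X$2$3, X$3$1, X$3$2, X$1$1, X$1$1 + X$2$2] ! (i - 1)"

lemma atLeastAtMost_1_8: "{1..8::nat} = {1,2,3,4,5,6,7,8}"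
  by auto

lemma coord_e: "coord i (e j) = (if i = j then 1 else 0)" if "i \<in> {1..8}" "j \<in> {1..8}"
  using that unfolding atLeastAtMost_1_8 by (auto simp: coord_def e_nth)

lemma coord_linear: "coord i (\<Sum>x\<in>S. c x *\<^sub>C x) = (\<Sum>x\<in>S. c x * coord i x)" if "i \<in> {1..8}"
  using that unfolding atLeastAtMost_1_8
  by (auto simp: coord_def sum.distrib algebra_simps)

lemma inj_e: "inj_on e {1..8}"
proof (rule inj_onI)
  fix i j :: nat assume ij: "i \<in> {1..8}" "j \<in> {1..8}" "e i = e j"
  have "coord i (e i) = coord i (e j)" using ij by simp
  then show "i = j" using ij(1,2) by (simp add: coord_e split: if_splits)
qed

lemma independent_e: "mat.independent (e ` {1..8})"
proof (rule mat.independent_if_scalars_zero)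
  fix c x assume sum0: "(\<Sum>x\<in>e ` {1..8}. c x *\<^sub>C x) = 0" and x: "x \<in> e ` {1..8}"
  from x obtain i where i: "i \<in> {1..8}" "x = e i" by blast
  have "0 = coord i (\<Sum>x\<in>e ` {1..8}. c x *\<^sub>C x)"
    unfolding sum0 using coord_linear[OF i(1), of c "{}"] by simp
  also have "\<dots> = (\<Sum>j\<in>{1..8}. c (e j) * coord i (e j))"
    using i(1) by (subst coord_linear) (simp_all only: sum.reindex[OF inj_e] o_def)
  also have "\<dots> = (\<Sum>j\<in>{1..8}. if i = j then c (e j) else 0)"
    using i(1) by (intro sum.cong) (simp_all add: coord_e)
  also have "\<dots> = c x" using i by simp
  finally show "c x = 0" by simp
qed simp

lemma sl3_iff: "X \<in> sl3 \<longleftrightarrow> X$3$3 = - X$1$1 - X$2$2"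
  by (auto simp: sl3_def trace_def sum_3 algebra_simps eq_neg_iff_add_eq_0)

lemma e_in_sl3: "i \<in> {1..8} \<Longrightarrow> e i \<in> sl3"
  unfolding atLeastAtMost_1_8 by (auto simp: sl3_iff e_nth)

lemma basis_expansion:
  assumes "X \<in> sl3"
  shows "X = X$1$2 *\<^sub>C e 1 + X$1$3 *\<^sub>C e 2 + X$2$1 *\<^sub>C e 3 + X$2$3 *\<^sub>C e 4 + X$3$1 *\<^sub>C e 5
    + X$3$2 *\<^sub>C e 6 + X$1$1 *\<^sub>C e 7 + (X$1$1 + X$2$2) *\<^sub>C e 8"
  using assms by (simp add: vec_eq_iff forall_3 e_nth sl3_iff del: One_nat_def)

lemma span_e: "mat.span (e ` {1..8}) = sl3"
proof (rule mat.span_subspace)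
  interpret lie_algebra mat_scale sl3 commutator by (rule sl3_lie_algebra)
  show "mat.subspace sl3" by (rule subspace)
  show "e ` {1..8} \<subseteq> sl3" by (auto intro: e_in_sl3)
  show "sl3 \<subseteq> mat.span (e ` {1..8})"
  proof
    fix X assume "X \<in> sl3"
    show "X \<in> mat.span (e ` {1..8})"
      by (subst basis_expansion[OF \<open>X \<in> sl3\<close>])
         (intro mat.span_add mat.span_scale mat.span_base imageI; simp)
  qed
qed

section \<open>The operator and its bracket\<close>

text \<open>
  Minus the projection onto \<open>\<bb>\<close>: among the basis elements only \<open>e\<^sub>3\<close> and \<open>e\<^sub>4\<close> have a nonzero entry
  at \<open>(2, 1)\<close> or \<open>(2, 3)\<close>, and these entries are the coordinates at \<open>e\<^sub>3\<close> and \<open>e\<^sub>4\<close>.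
\<close>

definition phi :: "complex^3^3 \<Rightarrow> complex^3^3" where
  "phi X = - (X$2$1 *\<^sub>C (e 3 + e 7) + X$2$3 *\<^sub>C (e 4 + e 5))"

lemma is_phi_phi: "is_phi phi"
  unfolding is_phi_def linear_on_def
  by (simp add: phi_def vec_eq_iff forall_3 e_nth sl3_iff algebra_simps)

lemma is_phi_unique:
  assumes "is_phi \<phi>" and X: "X \<in> sl3"
  shows "\<phi> X = phi X"
proof -
  interpret lie_algebra mat_scale sl3 commutator by (rule sl3_lie_algebra)
  have expand: "\<psi> X = X$1$2 *\<^sub>C \<psi> (e 1) + X$1$3 *\<^sub>C \<psi> (e 2) + X$2$1 *\<^sub>C \<psi> (e 3)
      + X$2$3 *\<^sub>C \<psi> (e 4) + X$3$1 *\<^sub>C \<psi> (e 5) + X$3$2 *\<^sub>C \<psi> (e 6) + X$1$1 *\<^sub>C \<psi> (e 7)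
      + (X$1$1 + X$2$2) *\<^sub>C \<psi> (e 8)" if "is_phi \<psi>" for \<psi>
  proof -
    have lin: "x \<in> sl3 \<Longrightarrow> y \<in> sl3 \<Longrightarrow> \<psi> (x + y) = \<psi> x + \<psi> y"
      "x \<in> sl3 \<Longrightarrow> \<psi> (c *\<^sub>C x) = c *\<^sub>C \<psi> x" for x y c
      using \<open>is_phi \<psi>\<close> unfolding is_phi_def linear_on_def by auto
    show ?thesis
      by (subst (1) basis_expansion[OF X]) (simp add: lin e_in_sl3 del: One_nat_def)
  qed
  show ?thesis
    unfolding expand[OF assms(1)] expand[OF is_phi_phi]
    using assms(1) is_phi_phi by (simp add: is_phi_def)
qed

lemma phi_rota_baxter: "rota_baxter_operator mat_scale sl3 commutator phi"
proof (rule splitting_rota_baxter[OF sl3_lie_algebra])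
  show "linear_on mat_scale mat_scale sl3 sl3 phi"
    using is_phi_phi by (simp add: is_phi_def)
  show "phi (phi x) = - phi x" for x
    by (simp add: phi_def vec_eq_iff forall_3 e_nth)
  have ker: "phi X = 0 \<longleftrightarrow> X$2$1 = 0 \<and> X$2$3 = 0" for X
    by (auto simp: phi_def vec_eq_iff forall_3 e_nth)
  show "phi (commutator x y) = 0" if "phi x = 0" "phi y = 0" for x y
    using that by (simp add: ker commutator_def matrix_matrix_mult_def sum_3)
  show "phi (commutator (phi x) (phi y)) = - commutator (phi x) (phi y)" for x y
    by (simp add: phi_def commutator_def matrix_matrix_mult_def sum_3 vec_eq_iff forall_3 e_nth
        algebra_simps)
qed

abbreviation g_bracket :: "complex^3^3 \<Rightarrow> complex^3^3 \<Rightarrow> complex^3^3" where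
  "g_bracket \<equiv> rb_bracket commutator phi"

text \<open>
  Here \<open>A = X + phi X\<close> is the component of \<open>X\<close> in \<open>\<aa>\<close>, and \<open>X\<^sub>2\<^sub>1, X\<^sub>2\<^sub>3\<close> are the coordinates of its
  component in \<open>\<bb>\<close>.
\<close>

definition to_aff :: "complex^3^3 \<Rightarrow> ((complex^2^2) \<times> (complex^2)) \<times> ((complex^1^1) \<times> (complex^1))"
  where "to_aff X = (let A = X + phi X in
    ((vector [vector [A$1$1 - A$2$2, A$1$3], vector [A$3$1, A$3$3 - A$2$2]],
      vector [A$1$2, A$3$2]),
     (vector [vector [X$2$1]], vector [X$2$3])))"

text \<open>
  The inverse of \<open>to_aff\<close>. Here \<open>d\<close> is the entry \<open>A\<^sub>2\<^sub>2\<close> of the component \<open>A\<close> in \<open>\<aa>\<close>: the given \<open>M\<close> is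
  the block of \<open>A\<close> minus \<open>d I\<close>, and this block has trace \<open>- d\<close> because \<open>A\<close> has trace \<open>0\<close>, so
  \<open>trace M = - 3 d\<close>.
\<close>

definition of_aff :: "((complex^2^2) \<times> (complex^2)) \<times> ((complex^1^1) \<times> (complex^1)) \<Rightarrow> complex^3^3"
  where "of_aff = (\<lambda>((M, v), (N, w)). let d = - (M$1$1 + M$2$2) / 3 in
    vector [vector [M$1$1 + d, v$1, M$1$2],
            vector [0, d, 0],
            vector [M$2$1, v$2, M$2$2 + d]]
    + N$1$1 *\<^sub>C (e 3 + e 7) + w$1 *\<^sub>C (e 4 + e 5))"

lemma iso_g_bracket: "iso_aff2_aff1 g_bracket"
proof -
  interpret rota_baxter_operator mat_scale sl3 commutator phi by (rule phi_rota_baxter)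
  interpret sum: vector_space_prod
    "aff_scale :: complex \<Rightarrow> (complex^2^2) \<times> (complex^2) \<Rightarrow> _"
    "aff_scale :: complex \<Rightarrow> (complex^1^1) \<times> (complex^1) \<Rightarrow> _" ..
  show ?thesis
    unfolding lie_isomorphic_def
  proof (intro conjI exI[of _ to_aff] ballI)
    show "lie_algebra mat_scale sl3 g_bracket" by (rule rb_bracket_lie_algebra)
    show "lie_algebra sum.scale (UNIV \<times> UNIV) (direct_sum_bracket aff_bracket aff_bracket)"
      by (intro direct_sum_lie_algebra aff_lie_algebra)
    show "linear_on mat_scale sum.scale sl3 (UNIV \<times> UNIV) to_aff"
      unfolding linear_on_def
      by (simp add: to_aff_def Let_def phi_def sum.scale_def aff_scale_apply vec_eq_iff forall_1
          forall_2 e_nth algebra_simps)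
    show "bij_betw to_aff sl3 (UNIV \<times> UNIV)"
    proof (rule bij_betw_byWitness[where f' = of_aff])
      show "\<forall>X\<in>sl3. of_aff (to_aff X) = X"
        by (simp add: of_aff_def to_aff_def Let_def phi_def vec_eq_iff forall_3 e_nth sl3_iff
            field_simps)
      show "\<forall>Y\<in>UNIV \<times> UNIV. to_aff (of_aff Y) = Y"
        by (auto simp: of_aff_def to_aff_def Let_def phi_def vec_eq_iff forall_1 forall_2 e_nth)
      show "of_aff ` (UNIV \<times> UNIV) \<subseteq> sl3"
        by (auto simp: of_aff_def Let_def sl3_iff e_nth field_simps)
    qed simp
    show "to_aff (g_bracket X Y) = direct_sum_bracket aff_bracket aff_bracket (to_aff X) (to_aff Y)"
      for X Y
      by (simp add: to_aff_def Let_def phi_def rb_bracket_def direct_sum_bracket_def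
          aff_bracket_def commutator_def matrix_matrix_mult_def matrix_vector_mult_def
          sum_1 sum_2 sum_3 vec_eq_iff forall_1 forall_2 e_nth algebra_simps)
  qed
qed

lemma phi_e:
  "phi (e 3) = - e 3 - e 7" "phi (e 4) = - e 4 - e 5"
  "phi (e (Suc 0)) = 0" "phi (e 2) = 0" "phi (e 5) = 0" "phi (e 6) = 0" "phi (e 7) = 0"
  "phi (e 8) = 0"
  using is_phi_phi by (simp_all add: is_phi_def)

lemma g_bracket_table:
  assumes "i \<in> {1..8}" "j \<in> {1..8}" "i < j"
  shows "g_bracket (e i) (e j) = table_entry g_table i j"
  using assms unfolding atLeastAtMost_1_8
  by (elim insertE emptyE; simp add: table_entry_def g_table_def rb_bracket_def phi_e commutator_zero;
      simp add: vec_eq_iff forall_3 commutator_nth_3 e_nth)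

lemma product_table_phi:
  assumes "i \<in> {1..8}" "j \<in> {1..8}"
  shows "commutator (phi (e i)) (e j) = table_entry product_table i j"
  using assms unfolding atLeastAtMost_1_8
  by (elim insertE emptyE; simp add: table_entry_def product_table_def phi_e commutator_zero;
      simp add: vec_eq_iff forall_3 commutator_nth_3 e_nth)

lemma post_lie_g_bracket:
  assumes "is_phi \<phi>"
  shows "post_lie_structure mat_scale sl3 g_bracket commutator (\<lambda>x y. commutator (\<phi> x) y)"
proof -
  interpret post_lie_structure mat_scale sl3 g_bracket commutator "\<lambda>x y. commutator (phi x) y"
    by (rule rota_baxter_post_lie[OF phi_rota_baxter])
  note [simp] = is_phi_unique[OF assms]
  show ?thesis
  proof unfold_locales
    show "bilinear_on mat_scale sl3 (\<lambda>x y. commutator (\<phi> x) y)"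
      using bilinear unfolding bilinear_on_def linear_on_def by simp
  qed (simp_all add: commutation action derivation)
qed

theorem proposition4p3:
  shows "inj_on e {1..8} \<and> \<not> module.dependent mat_scale (e ` {1..8}) \<and>
      module.span mat_scale (e ` {1..8}) = sl3 \<and>
    (\<exists>g p. post_lie_structure mat_scale sl3 g commutator p \<and> iso_aff2_aff1 g) \<and>
    (\<exists>\<phi>. is_phi \<phi>) \<and>
    (\<forall>\<phi>. is_phi \<phi> \<longrightarrow>
      (\<exists>g. post_lie_structure mat_scale sl3 g commutator (\<lambda>x y. commutator (\<phi> x) y) \<and>
           iso_aff2_aff1 g \<and>
           (\<forall>i j. 1 \<le> i \<and> i < j \<and> j \<le> 8 \<longrightarrow> g (e i) (e j) = table_entry g_table i j)) \<and>
      (\<forall>i\<in>{1..8}. \<forall>j\<in>{1..8}. commutator (\<phi> (e i)) (e j) = table_entry product_table i j))"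
proof (intro conjI allI impI)
  show "inj_on e {1..8}" by (rule inj_e)
  show "mat.independent (e ` {1..8})" by (rule independent_e)
  show "mat.span (e ` {1..8}) = sl3" by (rule span_e)
  show "\<exists>\<phi>. is_phi \<phi>" using is_phi_phi by blast
  show "\<exists>g p. post_lie_structure mat_scale sl3 g commutator p \<and> iso_aff2_aff1 g"
    using post_lie_g_bracket[OF is_phi_phi] iso_g_bracket by blast
  fix \<phi> assume phi: "is_phi \<phi>"
  show "\<exists>g. post_lie_structure mat_scale sl3 g commutator (\<lambda>x y. commutator (\<phi> x) y) \<and>
      iso_aff2_aff1 g \<and>
      (\<forall>i j. 1 \<le> i \<and> i < j \<and> j \<le> 8 \<longrightarrow> g (e i) (e j) = table_entry g_table i j)"
    using post_lie_g_bracket[OF phi] iso_g_bracket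
    by (intro exI[of _ g_bracket]) (simp add: g_bracket_table)
  show "\<forall>i\<in>{1..8}. \<forall>j\<in>{1..8}. commutator (\<phi> (e i)) (e j) = table_entry product_table i j"
    using product_table_phi by (simp add: is_phi_unique[OF phi] e_in_sl3)
qed

end
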